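(* The variety of $2$-dimensional Novikov--Poisson algebras over $\mathbb C$ has exactly two irreducible components: the closures $\overline{\bigcup_{\alpha,\beta\in\mathbb C}O(N_{07}^{\alpha,\beta})}$ and $\overline{\bigcup_{\alpha,\beta\in\mathbb C}O(N_{08}^{\alpha,\beta})}$.
   Context: A Novikov--Poisson algebra is a complex vector space with a commutative associative product $\cdot$ and a Novikov product $\circ$, i.e. a bilinear product with $(x\circ y)\circ z-x\circ(y\circ z)=(y\circ x)\circ z-y\circ(x\circ z)$ and $(x\circ y)\circ z=(x\circ z)\circ y$, such that $(x\cdot y)\circ z=x\cdot(y\circ z)$ and $(x\circ y)\cdot z-(y\circ x)\cdot z=x\circ(y\cdot z)-y\circ(x\cdot z)$. Fix a $2$-dimensional complex vector space $V$ with basis $e_1,e_2$. The variety of $2$-dimensional Novikov--Poisson algebras is the Zariski closed set of pairs $(\mu,\mu')\in \mathrm{Bil}(V\times V,V)^2\cong\mathbb C^{16}$ such that $\mu$ (as $\cdot$) and $\mu'$ (as $\circ$) define such an algebra. $\mathrm{GL}(V)$ acts on it by $(g*(\mu,\mu'))(x,y)=(g\mu(g^{-1}x,g^{-1}y),\,g\mu'(g^{-1}x,g^{-1}y))$; $O(T)$ denotes the orbit of (a structure representing) the algebra $T$, and closures are Zariski closures. The algebras are (unlisted products are zero, $\cdot$ is commutative): $N_{07}^{\alpha,\beta}: e_1\cdot e_1=e_1,\ e_2\cdot e_2=e_2,\ e_1\circ e_1=\alpha e_1,\ e_2\circ e_2=\beta e_2$; $N_{08}^{\alpha,\beta}: e_1\cdot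 e_1=e_1,\ e_1\cdot e_2=e_2,\ e_1\circ e_1=\alpha e_1+e_2,\ e_1\circ e_2=\beta e_2,\ e_2\circ e_1=\alpha e_2$. *)

theory Defs
  imports "HOL-Analysis.Analysis"
begin

section \<open>Irreducible components of a topological space\<close>

definition irreducible_in :: "'a topology \<Rightarrow> 'a set \<Rightarrow> bool" where
  "irreducible_in X S \<longleftrightarrow> S \<subseteq> topspace X \<and> S \<noteq> {} \<and>
     \<not> (\<exists>A B. closedin (subtopology X S) A \<and> closedin (subtopology X S) B \<and>
            A \<noteq> S \<and> B \<noteq> S \<and> A \<union> B = S)"

definition irreducible_components :: "'a topology \<Rightarrow> 'a set set" where
  "irreducible_components X =
     {S. irreducible_in X S \<and> (\<forall>T. irreducible_in X T \<and> S \<subseteq> T \<longrightarrow> T = S)}"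


section \<open>The Zariski topology defined by a set of coordinate functions\<close>

inductive_set poly_funs :: "('a \<Rightarrow> complex) set \<Rightarrow> ('a \<Rightarrow> complex) set"
  for C :: "('a \<Rightarrow> complex) set" where
  const: "(\<lambda>p. c) \<in> poly_funs C"
| coord: "f \<in> C \<Longrightarrow> f \<in> poly_funs C"
| add: "f \<in> poly_funs C \<Longrightarrow> g \<in> poly_funs C \<Longrightarrow> (\<lambda>p. f p + g p) \<in> poly_funs C"
| mult: "f \<in> poly_funs C \<Longrightarrow> g \<in> poly_funs C \<Longrightarrow> (\<lambda>p. f p * g p) \<in> poly_funs C"

definition zero_locus :: "'a set \<Rightarrow> ('a \<Rightarrow> complex) set \<Rightarrow> 'a set" where
  "zero_locus A F = {p \<in> A. \<forall>f\<in>F. f p = 0}"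

definition zariski_topology :: "'a set \<Rightarrow> ('a \<Rightarrow> complex) set \<Rightarrow> 'a topology" where
  "zariski_topology A C = topology (\<lambda>U. \<exists>F \<subseteq> poly_funs C. U = A - zero_locus A F)"

lemma istopology_zariski:
  "istopology (\<lambda>U. \<exists>F \<subseteq> poly_funs C. U = A - zero_locus A F)"
  unfolding istopology_def
proof (intro conjI allI impI)
  fix S T
  assume "\<exists>F \<subseteq> poly_funs C. S = A - zero_locus A F" "\<exists>F \<subseteq> poly_funs C. T = A - zero_locus A F"
  then obtain F G where F: "F \<subseteq> poly_funs C" "S = A - zero_locus A F"
    and G: "G \<subseteq> poly_funs C" "T = A - zero_locus A G"
    by blast
  let ?H = "{(\<lambda>p. f p * g p) | f g. f \<in> F \<and> g \<in> G}"
  have "?H \<subseteq> poly_funs C"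
    using F(1) G(1) by (auto intro: poly_funs.mult)
  moreover have "S \<inter> T = A - zero_locus A ?H"
    unfolding F(2) G(2) zero_locus_def by fastforce
  ultimately show "\<exists>F \<subseteq> poly_funs C. S \<inter> T = A - zero_locus A F"
    by blast
next
  fix K
  assume "\<forall>U\<in>K. \<exists>F \<subseteq> poly_funs C. U = A - zero_locus A F"
  then obtain F where F: "\<And>U. U \<in> K \<Longrightarrow> F U \<subseteq> poly_funs C \<and> U = A - zero_locus A (F U)"
    by metis
  have "(\<Union>U\<in>K. F U) \<subseteq> poly_funs C"
    using F by blast
  moreover have "\<Union>K = A - zero_locus A (\<Union>U\<in>K. F U)"
  proof -
    have "\<Union>K = (\<Union>U\<in>K. A - zero_locus A (F U))"
      using F by auto
    also have "\<dots> = A - zero_locus A (\<Union>U\<in>K. F U)"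
      by (auto simp: zero_locus_def)
    finally show ?thesis .
  qed
  ultimately show "\<exists>F \<subseteq> poly_funs C. \<Union>K = A - zero_locus A F"
    by blast
qed

lemma openin_zariski:
  "openin (zariski_topology A C) U \<longleftrightarrow> (\<exists>F \<subseteq> poly_funs C. U = A - zero_locus A F)"
  unfolding zariski_topology_def topology_inverse'[OF istopology_zariski] ..

lemma topspace_zariski [simp]: "topspace (zariski_topology A C) = A"
proof -
  have "openin (zariski_topology A C) A"
    unfolding openin_zariski zero_locus_def
    by (rule exI[of _ "{\<lambda>p. 1}"]) (auto intro: poly_funs.const)
  moreover have "topspace (zariski_topology A C) \<subseteq> A"
    using openin_topspace[of "zariski_topology A C"] unfolding openin_zariski by auto
  ultimately show ?thesis
    by (auto dest: openin_subset)
qed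

lemma closedin_zariski:
  "closedin (zariski_topology A C) S \<longleftrightarrow> (\<exists>F \<subseteq> poly_funs C. S = zero_locus A F)"
proof -
  have "zero_locus A F \<subseteq> A" for F
    by (auto simp: zero_locus_def)
  then show ?thesis
    unfolding closedin_def openin_zariski topspace_zariski
    by (metis double_diff order_refl)
qed


section \<open>Pairs of bilinear products on a plane\<close>

text \<open>The vector space is \<^typ>\<open>complex^2\<close> with its standard basis. Linearity over the complex
  numbers is linearity with respect to \<^term>\<open>(*s)\<close>; the library's \<^const>\<open>linear\<close> and
  \<^const>\<open>bilinear\<close> only express real (bi)linearity.\<close>

type_synonym prod2 = "complex^2 \<Rightarrow> complex^2 \<Rightarrow> complex^2"

abbreviation clinear2 :: "(complex^2 \<Rightarrow> complex^2) \<Rightarrow> bool" where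
  "clinear2 \<equiv> Vector_Spaces.linear (*s) (*s)"

definition Bil :: "prod2 set" where
  "Bil = {\<mu>. (\<forall>x. clinear2 (\<lambda>y. \<mu> x y)) \<and> (\<forall>y. clinear2 (\<lambda>x. \<mu> x y))}"

definition basis2 :: "2 \<Rightarrow> complex^2" where
  "basis2 i = axis i 1"

text \<open>The sixteen structure constants, which identify \<^term>\<open>Bil \<times> Bil\<close> with
  complex affine 16-space.\<close>

definition structure_consts :: "(prod2 \<times> prod2 \<Rightarrow> complex) set" where
  "structure_consts =
     {(\<lambda>p. fst p (basis2 i) (basis2 j) $ k) | i j k. True} \<union>
     {(\<lambda>p. snd p (basis2 i) (basis2 j) $ k) | i j k. True}"

definition zariski :: "(prod2 \<times> prod2) topology" where
  "zariski = zariski_topology (Bil \<times> Bil) structure_consts"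


section \<open>Novikov--Poisson structures\<close>

definition comm_assoc_prod :: "prod2 \<Rightarrow> bool" where
  "comm_assoc_prod m \<longleftrightarrow>
     (\<forall>x y. m x y = m y x) \<and> (\<forall>x y z. m (m x y) z = m x (m y z))"

definition novikov_prod :: "prod2 \<Rightarrow> bool" where
  "novikov_prod n \<longleftrightarrow>
     (\<forall>x y z. n (n x y) z - n x (n y z) = n (n y x) z - n y (n x z)) \<and>
     (\<forall>x y z. n (n x y) z = n (n x z) y)"

definition novikov_poisson_compat :: "prod2 \<Rightarrow> prod2 \<Rightarrow> bool" where
  "novikov_poisson_compat m n \<longleftrightarrow>
     (\<forall>x y z. n (m x y) z = m x (n y z)) \<and>
     (\<forall>x y z. m (n x y) z - m (n y x) z = n x (m y z) - n y (m x z))"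

definition NP_variety :: "(prod2 \<times> prod2) set" where
  "NP_variety = {(m, n). m \<in> Bil \<and> n \<in> Bil \<and>
     comm_assoc_prod m \<and> novikov_prod n \<and> novikov_poisson_compat m n}"

definition GL2 :: "(complex^2 \<Rightarrow> complex^2) set" where
  "GL2 = {g. clinear2 g \<and> bij g}"

definition transport :: "(complex^2 \<Rightarrow> complex^2) \<Rightarrow> prod2 \<Rightarrow> prod2" where
  "transport g m = (\<lambda>x y. g (m (inv g x) (inv g y)))"

definition orbit :: "prod2 \<times> prod2 \<Rightarrow> (prod2 \<times> prod2) set" where
  "orbit p = {(transport g (fst p), transport g (snd p)) | g. g \<in> GL2}"

text \<open>\<open>prod_table a b c d\<close> is the bilinear product with
  \<open>e1 e1 = a\<close>, \<open>e1 e2 = b\<close>, \<open>e2 e1 = c\<close>, \<open>e2 e2 = d\<close>.\<close>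

definition prod_table ::
    "complex^2 \<Rightarrow> complex^2 \<Rightarrow> complex^2 \<Rightarrow> complex^2 \<Rightarrow> prod2" where
  "prod_table a b c d = (\<lambda>x y.
     (x$1 * y$1) *s a + (x$1 * y$2) *s b + (x$2 * y$1) *s c + (x$2 * y$2) *s d)"

abbreviation e1 :: "complex^2" where "e1 \<equiv> basis2 1"
abbreviation e2 :: "complex^2" where "e2 \<equiv> basis2 2"

definition N07 :: "complex \<Rightarrow> complex \<Rightarrow> prod2 \<times> prod2" where
  "N07 \<alpha> \<beta> = (prod_table e1 0 0 e2, prod_table (\<alpha> *s e1) 0 0 (\<beta> *s e2))"

definition N08 :: "complex \<Rightarrow> complex \<Rightarrow> prod2 \<times> prod2" where
  "N08 \<alpha> \<beta> =
     (prod_table e1 e2 e2 0, prod_table (\<alpha> *s e1 + e2) (\<beta> *s e2) (\<alpha> *s e2) 0)"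

lemma prod_table_basis:
  "prod_table a b c d e1 e1 = a" "prod_table a b c d e1 e2 = b"
  "prod_table a b c d e2 e1 = c" "prod_table a b c d e2 e2 = d"
  by (simp_all add: prod_table_def basis2_def axis_def)

lemma clinear2_iff:
  "clinear2 f \<longleftrightarrow> (\<forall>x y. f (x + y) = f x + f y) \<and> (\<forall>c x. f (c *s x) = c *s f x)"
  by (simp add: Vector_Spaces.linear_iff vec.vector_space_axioms)

lemma prod_table_Bil: "prod_table a b c d \<in> Bil"
  by (auto simp: Bil_def prod_table_def clinear2_iff vec_eq_iff algebra_simps)

lemma N07_in_variety: "N07 \<alpha> \<beta> \<in> NP_variety"
  unfolding N07_def NP_variety_def mem_Collect_eq prod.case
  by (intro conjI prod_table_Bil)
    (auto simp: comm_assoc_prod_def novikov_prod_def novikov_poisson_compat_def prod_table_def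
      basis2_def axis_def vec_eq_iff forall_2 algebra_simps)

lemma N08_in_variety: "N08 \<alpha> \<beta> \<in> NP_variety"
  unfolding N08_def NP_variety_def mem_Collect_eq prod.case
  by (intro conjI prod_table_Bil)
    (auto simp: comm_assoc_prod_def novikov_prod_def novikov_poisson_compat_def prod_table_def
      basis2_def axis_def vec_eq_iff forall_2 algebra_simps)

lemma Bil_expand:
  assumes "m \<in> Bil"
  shows "m x y $ k = (\<Sum>i\<in>UNIV. \<Sum>j\<in>UNIV. x $ i * y $ j * m (basis2 i) (basis2 j) $ k)"
proof -
  have dec: "v = v $ 1 *s e1 + v $ 2 *s e2" for v :: "complex^2"
    by (simp add: vec_eq_iff forall_2 basis2_def axis_def)
  have L: "m (u + v) w = m u w + m v w" "m (c *s u) w = c *s m u w"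
    and R: "m w (u + v) = m w u + m w v" "m w (c *s u) = c *s m w u" for u v w c
    using assms by (auto simp: Bil_def clinear2_iff)
  have "m x y = m (x $ 1 *s e1 + x $ 2 *s e2) (y $ 1 *s e1 + y $ 2 *s e2)"
    using dec[of x] dec[of y] by simp
  then show ?thesis
    by (simp add: L R sum_2 algebra_simps)
qed

text \<open>Polynomial functions are only considered up to equality on \<^term>\<open>Bil \<times> Bil\<close>.\<close>

definition regular_on_Bil :: "(prod2 \<times> prod2 \<Rightarrow> complex) \<Rightarrow> bool" where
  "regular_on_Bil f \<longleftrightarrow> (\<exists>g \<in> poly_funs structure_consts. \<forall>p \<in> Bil \<times> Bil. f p = g p)"

lemma regular_const: "regular_on_Bil (\<lambda>p. c)"
  unfolding regular_on_Bil_def by (rule bexI[OF _ poly_funs.const[of c]]) simp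

lemma regular_add:
  assumes "regular_on_Bil f" "regular_on_Bil g"
  shows "regular_on_Bil (\<lambda>p. f p + g p)"
proof -
  obtain f' g' where "f' \<in> poly_funs structure_consts" "\<forall>p \<in> Bil \<times> Bil. f p = f' p"
    "g' \<in> poly_funs structure_consts" "\<forall>p \<in> Bil \<times> Bil. g p = g' p"
    using assms unfolding regular_on_Bil_def by blast
  then show ?thesis
    unfolding regular_on_Bil_def
    by (intro bexI[where x="\<lambda>p. f' p + g' p"]) (auto intro: poly_funs.add)
qed

lemma regular_mult:
  assumes "regular_on_Bil f" "regular_on_Bil g"
  shows "regular_on_Bil (\<lambda>p. f p * g p)"
proof -
  obtain f' g' where "f' \<in> poly_funs structure_consts" "\<forall>p \<in> Bil \<times> Bil. f p = f' p"
    "g' \<in> poly_funs structure_consts" "\<forall>p \<in> Bil \<times> Bil. g p = g' p"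
    using assms unfolding regular_on_Bil_def by blast
  then show ?thesis
    unfolding regular_on_Bil_def
    by (intro bexI[where x="\<lambda>p. f' p * g' p"]) (auto intro: poly_funs.mult)
qed

lemma regular_diff:
  assumes "regular_on_Bil f" "regular_on_Bil g"
  shows "regular_on_Bil (\<lambda>p. f p - g p)"
  using regular_add[OF assms(1) regular_mult[OF regular_const[of "-1"] assms(2)]] by simp

lemma regular_prod:
  assumes "s = fst \<or> s = snd"
    and "\<And>i. regular_on_Bil (\<lambda>p. a p $ i)" "\<And>j. regular_on_Bil (\<lambda>p. b p $ j)"
  shows "regular_on_Bil (\<lambda>p. s p (a p) (b p) $ k)"
proof -
  have c: "regular_on_Bil (\<lambda>p. s p (basis2 i) (basis2 j) $ k)" for i j
  proof -
    have "(\<lambda>p. s p (basis2 i) (basis2 j) $ k) \<in> structure_consts"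
      using assms(1) unfolding structure_consts_def by blast
    then show ?thesis
      unfolding regular_on_Bil_def by (intro bexI[OF _ poly_funs.coord]) auto
  qed
  have "regular_on_Bil
    (\<lambda>p. \<Sum>i\<in>UNIV. \<Sum>j\<in>UNIV. a p $ i * b p $ j * s p (basis2 i) (basis2 j) $ k)"
    unfolding sum_2 by (intro regular_add regular_mult assms(2,3) c)
  then obtain g where g: "g \<in> poly_funs structure_consts"
    "\<forall>p \<in> Bil \<times> Bil.
       (\<Sum>i\<in>UNIV. \<Sum>j\<in>UNIV. a p $ i * b p $ j * s p (basis2 i) (basis2 j) $ k) = g p"
    unfolding regular_on_Bil_def by blast
  moreover have "s p (a p) (b p) $ k =
      (\<Sum>i\<in>UNIV. \<Sum>j\<in>UNIV. a p $ i * b p $ j * s p (basis2 i) (basis2 j) $ k)"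
    if "p \<in> Bil \<times> Bil" for p
    using that assms(1) by (intro Bil_expand) auto
  ultimately show ?thesis
    unfolding regular_on_Bil_def by auto
qed

lemma closedin_regular:
  assumes "regular_on_Bil f"
  shows "closedin zariski {p \<in> Bil \<times> Bil. f p = 0}"
proof -
  obtain g where "g \<in> poly_funs structure_consts" "\<forall>p \<in> Bil \<times> Bil. f p = g p"
    using assms unfolding regular_on_Bil_def by blast
  then show ?thesis
    unfolding zariski_def closedin_zariski
    by (intro exI[where x="{g}"]) (auto simp: zero_locus_def)
qed

lemma closedin_identity:
  assumes "\<And>x y z k. regular_on_Bil (\<lambda>p. F x y z p $ k)"
    and "\<And>x y z k. regular_on_Bil (\<lambda>p. G x y z p $ k)"
  shows "closedin zariski {p \<in> Bil \<times> Bil. \<forall>x y z. F x y z p = (G x y z p :: complex^2)}"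
proof -
  let ?S = "\<lambda>(x, y, z, k). {p \<in> Bil \<times> Bil. F x y z p $ k - G x y z p $ k = 0}"
  have "closedin zariski (\<Inter>t\<in>UNIV. ?S t)"
    by (intro closedin_INT) (auto simp del: right_minus_eq intro!: closedin_regular regular_diff assms)
  moreover have "(\<Inter>t\<in>UNIV. ?S t) = {p \<in> Bil \<times> Bil. \<forall>x y z. F x y z p = G x y z p}"
    by (auto simp: vec_eq_iff)
  ultimately show ?thesis by simp
qed

lemma closedin_NP_variety: "closedin zariski NP_variety"
proof -
  note reg = regular_prod[where s=fst] regular_prod[where s=snd] regular_const regular_diff
  let ?C = "\<lambda>F G. {p \<in> Bil \<times> Bil. \<forall>x y z. F x y z p = (G x y z p :: complex^2)}"
  have eq: "NP_variety =
      ?C (\<lambda>x y z p. fst p x y) (\<lambda>x y z p. fst p y x)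
    \<inter> ?C (\<lambda>x y z p. fst p (fst p x y) z) (\<lambda>x y z p. fst p x (fst p y z))
    \<inter> ?C (\<lambda>x y z p. snd p (snd p x y) z - snd p x (snd p y z))
         (\<lambda>x y z p. snd p (snd p y x) z - snd p y (snd p x z))
    \<inter> ?C (\<lambda>x y z p. snd p (snd p x y) z) (\<lambda>x y z p. snd p (snd p x z) y)
    \<inter> ?C (\<lambda>x y z p. snd p (fst p x y) z) (\<lambda>x y z p. fst p x (snd p y z))
    \<inter> ?C (\<lambda>x y z p. fst p (snd p x y) z - fst p (snd p y x) z)
         (\<lambda>x y z p. snd p x (fst p y z) - snd p y (fst p x z))"
    unfolding NP_variety_def comm_assoc_prod_def novikov_prod_def novikov_poisson_compat_def
    by auto
  show ?thesis
    by (subst eq, intro closedin_Int; rule closedin_identity;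
        (simp only: vector_minus_component)?;
        intro reg disjI1[OF refl] disjI2[OF refl])
qed

end

theory Submission
  imports Defs
begin

text \<open>Call a structure diagonal if in some basis \<open>u, v\<close> both products are diagonal, and
  triangular if in some basis
  \<open>u\<cdot>u = l u + k v\<close>, \<open>u\<cdot>v = v\<cdot>u = l v\<close>, \<open>v\<cdot>v = 0\<close>,
  \<open>u\<circ>u = a u + c v\<close>, \<open>u\<circ>v = b v\<close>, \<open>v\<circ>u = a v\<close>, \<open>v\<circ>v = 0\<close>.
  Both conditions are linear in a fixed basis and hence stable under rescaling, so transport of
  structure can be written with the adjugate instead of the inverse. Thus both sets are images of
  polynomial maps from affine space, and so irreducible; generic diagonal (triangular) structures
  are isomorphic to some \<open>N07\<close> (\<open>N08\<close>).

  Every structure is of one of the two kinds. If \<open>\<circ>\<close> is commutative, all multiplication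
  operators commute: either one of them has two eigenvalues and they are simultaneously
  diagonalisable, or they are all triangular in a common basis with a single eigenvalue each. If
  \<open>\<circ>\<close> is not commutative, there is a basis with \<open>u\<circ>v - v\<circ>u = v\<close>, and in such
  a basis the identities force the triangular form. Commutativity of \<open>\<circ>\<close> and the
  discriminant of multiplication by \<open>e1\<close> separate the two closures.\<close>

section \<open>Irreducibility\<close>

text \<open>Closed sets of the subspace are traces of closed sets of \<open>X\<close>, so a
  decomposition of \<open>S\<close> amounts to a cover by two closed sets of \<open>X\<close>. In
  this form irreducibility passes easily to closures and images.\<close>

lemma irreducible_in_iff:
  "irreducible_in X S \<longleftrightarrow> S \<subseteq> topspace X \<and> S \<noteq> {} \<and>
     (\<forall>A B. closedin X A \<and> closedin X B \<and> S \<subseteq> A \<union> B \<longrightarrow> S \<subseteq> A \<or> S \<subseteq> B)"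
    (is "?L \<longleftrightarrow> ?R")
proof
  assume L: ?L
  show ?R
  proof (intro conjI allI impI)
    fix A B assume AB: "closedin X A \<and> closedin X B \<and> S \<subseteq> A \<union> B"
    have "closedin (subtopology X S) (S \<inter> A)" "closedin (subtopology X S) (S \<inter> B)"
      using AB by (auto simp: closedin_subtopology)
    moreover have "(S \<inter> A) \<union> (S \<inter> B) = S"
      using AB by blast
    ultimately have "S \<inter> A = S \<or> S \<inter> B = S"
      using L unfolding irreducible_in_def by blast
    then show "S \<subseteq> A \<or> S \<subseteq> B" by blast
  qed (use L in \<open>auto simp: irreducible_in_def\<close>)
next
  assume R: ?R
  have False if "closedin (subtopology X S) A" "closedin (subtopology X S) B"
    "A \<noteq> S" "B \<noteq> S" "A \<union> B = S" for A B
  proof -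
    obtain A' B' where "closedin X A'" "A = A' \<inter> S" "closedin X B'" "B = B' \<inter> S"
      using \<open>closedin (subtopology X S) A\<close> \<open>closedin (subtopology X S) B\<close>
      by (auto simp: closedin_subtopology)
    moreover from this that(5) have "S \<subseteq> A' \<union> B'" by blast
    ultimately have "S \<subseteq> A' \<or> S \<subseteq> B'" using R by blast
    then show False using that \<open>A = A' \<inter> S\<close> \<open>B = B' \<inter> S\<close> by blast
  qed
  then have "\<not> (\<exists>A B. closedin (subtopology X S) A \<and> closedin (subtopology X S) B \<and>
      A \<noteq> S \<and> B \<noteq> S \<and> A \<union> B = S)"
    by (intro notI) (elim exE conjE)
  then show ?L using R unfolding irreducible_in_def by simp
qed

lemma irreducible_in_closure_of:
  assumes "irreducible_in X S"
  shows "irreducible_in X (X closure_of S)"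
proof -
  have sub: "S \<subseteq> X closure_of S"
    using assms by (intro closure_of_subset) (simp add: irreducible_in_iff)
  show ?thesis
    unfolding irreducible_in_iff[of X "X closure_of S"]
  proof (intro conjI allI impI)
    show "X closure_of S \<noteq> {}"
      using sub assms by (auto simp: irreducible_in_iff)
    fix A B assume AB: "closedin X A \<and> closedin X B \<and> X closure_of S \<subseteq> A \<union> B"
    then have "S \<subseteq> A \<union> B"
      using sub by (blast intro: subset_trans)
    then have "S \<subseteq> A \<or> S \<subseteq> B"
      using assms AB by (simp add: irreducible_in_iff)
    then show "X closure_of S \<subseteq> A \<or> X closure_of S \<subseteq> B"
      using AB closure_of_minimal[of S A X] closure_of_minimal[of S B X] by blast
  qed (rule closure_of_subset_topspace)
qed

lemma irreducible_in_subtopology: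
  assumes "irreducible_in X S" "S \<subseteq> Z"
  shows "irreducible_in (subtopology X Z) S"
proof -
  have "subtopology (subtopology X Z) S = subtopology X S"
    using assms(2) by (simp add: subtopology_subtopology Int_absorb1)
  then show ?thesis
    using assms by (simp add: irreducible_in_def)
qed

text \<open>An irreducible set covered by the closed sets \<open>C\<close> and \<open>D\<close> lies
  in one of them, so only these two can be maximal; as neither contains the other, both are.\<close>

lemma irreducible_components_two:
  assumes top: "topspace X = C \<union> D"
    and cl: "closedin X C" "closedin X D"
    and irr: "irreducible_in X C" "irreducible_in X D"
    and nsub: "\<not> C \<subseteq> D" "\<not> D \<subseteq> C"
  shows "irreducible_components X = {C, D}"
proof -
  have dich: "T \<subseteq> C \<or> T \<subseteq> D" if "irreducible_in X T" for T
  proof -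
    have "T \<subseteq> C \<union> D"
      using that top unfolding irreducible_in_iff by simp
    then show ?thesis
      using that cl unfolding irreducible_in_iff by simp
  qed
  show ?thesis
  proof (intro equalityI subsetI)
    fix S assume "S \<in> irreducible_components X"
    then have S: "irreducible_in X S" "\<And>T. irreducible_in X T \<Longrightarrow> S \<subseteq> T \<Longrightarrow> T = S"
      by (auto simp: irreducible_components_def)
    show "S \<in> {C, D}"
      using dich[OF S(1)] S(2)[OF irr(1)] S(2)[OF irr(2)] by blast
  next
    fix S assume S: "S \<in> {C, D}"
    have "T = S" if T: "irreducible_in X T" "S \<subseteq> T" for T
      using S dich[OF T(1)] T(2) nsub by (elim insertE disjE) auto
    then show "S \<in> irreducible_components X"
      using S irr by (auto simp: irreducible_components_def)
  qed
qed


section \<open>Polynomially parametrised families\<close>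

definition is_cpoly :: "(complex \<Rightarrow> complex) \<Rightarrow> bool" where
  "is_cpoly h \<longleftrightarrow> (\<exists>P. \<forall>t. h t = poly P t)"

lemma is_cpoly_const: "is_cpoly (\<lambda>t. c)"
  unfolding is_cpoly_def by (intro exI[of _ "[:c:]"]) simp

lemma is_cpoly_id: "is_cpoly (\<lambda>t. t)"
  unfolding is_cpoly_def by (intro exI[of _ "[:0, 1:]"]) simp

lemma is_cpoly_add: "is_cpoly f \<Longrightarrow> is_cpoly g \<Longrightarrow> is_cpoly (\<lambda>t. f t + g t)"
  unfolding is_cpoly_def by (metis poly_add)

lemma is_cpoly_diff: "is_cpoly f \<Longrightarrow> is_cpoly g \<Longrightarrow> is_cpoly (\<lambda>t. f t - g t)"
  unfolding is_cpoly_def by (metis poly_diff)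

lemma is_cpoly_mult: "is_cpoly f \<Longrightarrow> is_cpoly g \<Longrightarrow> is_cpoly (\<lambda>t. f t * g t)"
  unfolding is_cpoly_def by (metis poly_mult)

lemmas is_cpoly_intros =
  is_cpoly_const is_cpoly_id is_cpoly_add is_cpoly_diff is_cpoly_mult

text \<open>The complex numbers are infinite, so a polynomial vanishing everywhere is zero, and
  polynomials form an integral domain.\<close>

lemma is_cpoly_no_zero_divisors:
  assumes "is_cpoly f" "is_cpoly g" "\<And>t. f t = 0 \<or> g t = 0" "g s \<noteq> 0"
  shows "f t = 0"
proof -
  obtain P Q where P: "\<And>t. f t = poly P t" and Q: "\<And>t. g t = poly Q t"
    using assms(1,2) unfolding is_cpoly_def by blast
  have "poly (P * Q) t = 0" for t
    using assms(3)[of t] by (simp add: P Q)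
  then have "P * Q = 0"
    using poly_all_0_iff_0 by blast
  moreover have "Q \<noteq> 0"
    using assms(4) Q by auto
  ultimately show ?thesis
    by (simp add: P)
qed

definition line :: "(nat \<Rightarrow> complex) \<Rightarrow> (nat \<Rightarrow> complex) \<Rightarrow> complex \<Rightarrow> nat \<Rightarrow> complex" where
  "line w w' t i = w i + t * (w' i - w i)"

lemma line_ends [simp]: "line w w' 0 = w" "line w w' 1 = w'"
  by (auto simp: line_def)

lemma is_cpoly_line: "is_cpoly (\<lambda>t. line w w' t i)"
  unfolding line_def by (intro is_cpoly_intros)

text \<open>A parameter is a sequence of which each concrete family reads only finitely many
  entries. Polynomial dependence is tested along affine lines only, which is all that the density
  and irreducibility arguments use.\<close>

definition poly_param :: "((nat \<Rightarrow> complex) \<Rightarrow> prod2 \<times> prod2) \<Rightarrow> bool" where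
  "poly_param \<Phi> \<longleftrightarrow> range \<Phi> \<subseteq> Bil \<times> Bil \<and>
     (\<forall>f\<in>structure_consts. \<forall>w w'. is_cpoly (\<lambda>t. f (\<Phi> (line w w' t))))"

lemma poly_param_poly_funs:
  assumes "poly_param \<Phi>" "f \<in> poly_funs structure_consts"
  shows "is_cpoly (\<lambda>t. f (\<Phi> (line w w' t)))"
  using assms(2)
proof induction
  case (coord f)
  then show ?case using assms(1) unfolding poly_param_def by blast
qed (auto intro: is_cpoly_intros)

text \<open>If the image left both \<open>A\<close> and \<open>B\<close>, join a parameter outside
  \<open>A\<close> to one outside \<open>B\<close> by a line. On it two nonzero polynomials would
  have an identically zero product.\<close>

lemma irreducible_in_range_poly_param:
  assumes "poly_param \<Phi>"
  shows "irreducible_in zariski (range \<Phi>)"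
  unfolding irreducible_in_iff
proof (intro conjI allI impI)
  have Bil: "range \<Phi> \<subseteq> Bil \<times> Bil"
    using assms unfolding poly_param_def by blast
  then show "range \<Phi> \<subseteq> topspace zariski"
    by (simp add: zariski_def)
  fix A B assume AB: "closedin zariski A \<and> closedin zariski B \<and> range \<Phi> \<subseteq> A \<union> B"
  then obtain F G where F: "F \<subseteq> poly_funs structure_consts" "A = zero_locus (Bil \<times> Bil) F"
    and G: "G \<subseteq> poly_funs structure_consts" "B = zero_locus (Bil \<times> Bil) G"
    unfolding zariski_def closedin_zariski by blast
  show "range \<Phi> \<subseteq> A \<or> range \<Phi> \<subseteq> B"
  proof (rule ccontr)
    assume "\<not> ?thesis"
    then obtain w w' where "\<Phi> w \<notin> A" "\<Phi> w' \<notin> B" by blast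
    then obtain f g where f: "f \<in> F" "f (\<Phi> w) \<noteq> 0" and g: "g \<in> G" "g (\<Phi> w') \<noteq> 0"
      using Bil unfolding F(2) G(2) zero_locus_def by blast
    have "f (\<Phi> (line w w' t)) = 0 \<or> g (\<Phi> (line w w' t)) = 0" for t
    proof -
      have "\<Phi> (line w w' t) \<in> A \<union> B" using AB by blast
      then show ?thesis using f(1) g(1) unfolding F(2) G(2) zero_locus_def by blast
    qed
    then have "f (\<Phi> (line w w' 0)) = 0"
      using poly_param_poly_funs[OF assms] f(1) F(1) g G(1)
      by (intro is_cpoly_no_zero_divisors[where g="\<lambda>t. g (\<Phi> (line w w' t))" and s=1
          and f="\<lambda>t. f (\<Phi> (line w w' t))"])
        auto
    then show False using f(2) by simp
  qed
qed auto

text \<open>The parameters with \<open>h \<noteq> 0\<close> are dense: an equation of the closure of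
  \<open>S\<close> vanishes on them, and on the line from any \<open>w\<close> to \<open>w1\<close>
  the factor \<open>h\<close> is not identically zero, so the equation vanishes at \<open>w\<close>
  as well.\<close>

lemma range_poly_param_subset_closure:
  assumes "poly_param \<Phi>"
    and h: "\<And>w w'. is_cpoly (\<lambda>t. h (line w w' t))" "h w1 \<noteq> 0"
    and S: "S \<subseteq> Bil \<times> Bil" "\<And>w. h w \<noteq> 0 \<Longrightarrow> \<Phi> w \<in> S"
  shows "range \<Phi> \<subseteq> zariski closure_of S"
proof -
  have "closedin zariski (zariski closure_of S)" by simp
  then obtain F where F: "F \<subseteq> poly_funs structure_consts"
    "zariski closure_of S = zero_locus (Bil \<times> Bil) F"
    unfolding zariski_def closedin_zariski by blast
  have sub: "S \<subseteq> zariski closure_of S"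
    using S(1) by (intro closure_of_subset) (simp add: zariski_def)
  have "f (\<Phi> w) = 0" if "f \<in> F" for f w
  proof -
    have "f (\<Phi> (line w w1 t)) = 0 \<or> h (line w w1 t) = 0" for t
      using S(2) sub that unfolding F(2) zero_locus_def by blast
    then have "f (\<Phi> (line w w1 0)) = 0"
      using poly_param_poly_funs[OF assms(1)] that F(1) h
      by (intro is_cpoly_no_zero_divisors[where g="\<lambda>t. h (line w w1 t)" and s=1
          and f="\<lambda>t. f (\<Phi> (line w w1 t))"])
        auto
    then show ?thesis by simp
  qed
  then show ?thesis
    using assms(1) unfolding F(2) zero_locus_def poly_param_def by blast
qed


section \<open>Products in a frame\<close>

definition det2 :: "complex^2 \<Rightarrow> complex^2 \<Rightarrow> complex" where
  "det2 u v = u$1 * v$2 - u$2 * v$1"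

text \<open>Cramer's rule with the denominators \<^term>\<open>(det2 u v)^2\<close> cleared: the result is polynomial
  in the frame, and for \<^term>\<open>a = r u u\<close> etc. it is \<^term>\<open>(det2 u v)^2\<close> times the
  product \<open>r\<close>.\<close>

definition frame_prod ::
    "complex^2 \<Rightarrow> complex^2 \<Rightarrow> complex^2 \<Rightarrow> complex^2 \<Rightarrow> complex^2 \<Rightarrow> complex^2 \<Rightarrow> prod2" where
  "frame_prod u v a b c d = (\<lambda>x y.
     (det2 x v * det2 y v) *s a + (det2 x v * det2 u y) *s b +
     (det2 u x * det2 y v) *s c + (det2 u x * det2 u y) *s d)"

lemma frame_prod_Bil: "frame_prod u v a b c d \<in> Bil"
  by (auto simp: Bil_def frame_prod_def clinear2_iff vec_eq_iff det2_def algebra_simps)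

lemma frame_prod_frame:
  "frame_prod u v a b c d u u = (det2 u v)\<^sup>2 *s a"
  "frame_prod u v a b c d u v = (det2 u v)\<^sup>2 *s b"
  "frame_prod u v a b c d v u = (det2 u v)\<^sup>2 *s c"
  "frame_prod u v a b c d v v = (det2 u v)\<^sup>2 *s d"
  by (simp_all add: frame_prod_def det2_def vec_eq_iff forall_2 power2_eq_square algebra_simps)

lemma Bil_lin:
  assumes "m \<in> Bil"
  shows "m (x + y) z = m x z + m y z" "m (c *s x) z = c *s m x z"
    "m z (x + y) = m z x + m z y" "m z (c *s x) = c *s m z x"
  using assms by (auto simp: Bil_def clinear2_iff)

text \<open>Cramer's rule.\<close>

lemma frame_expand:
  assumes "det2 u v \<noteq> 0"
  shows "x = (det2 x v / det2 u v) *s u + (det2 u x / det2 u v) *s v"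
proof -
  have "det2 u v * x $ i = det2 x v * u $ i + det2 u x * v $ i" for i
    using exhaust_2[of i] by (auto simp: det2_def algebra_simps)
  then have "x $ i = (det2 x v * u $ i + det2 u x * v $ i) / det2 u v" for i
    using assms by (simp add: field_simps)
  then show ?thesis
    by (simp add: vec_eq_iff add_divide_distrib)
qed

lemma frame_coeffs:
  assumes "det2 u v \<noteq> 0"
  obtains a b where "x = a *s u + b *s v"
  using frame_expand[OF assms] by blast

lemma frame_eq_iff:
  assumes "det2 u v \<noteq> 0"
  shows "a *s u + b *s v = a' *s u + b' *s v \<longleftrightarrow> a = a' \<and> b = b'"
proof
  assume eq: "a *s u + b *s v = a' *s u + b' *s v"
  have "det2 (a *s u + b *s v) v = a * det2 u v" "det2 u (a *s u + b *s v) = b * det2 u v" for a b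
    by (simp_all add: det2_def algebra_simps)
  then show "a = a' \<and> b = b'"
    using eq assms by (metis mult_cancel_right)
qed simp

text \<open>The factor \<open>k\<close> undoes the square of the determinant that
  \<open>frame_prod\<close> carries.\<close>

lemma Bil_eq_frame_prod:
  assumes "r \<in> Bil" "det2 u v \<noteq> 0"
  defines "k \<equiv> 1 / (det2 u v)\<^sup>2"
  shows "r = frame_prod u v (k *s r u u) (k *s r u v) (k *s r v u) (k *s r v v)"
proof (intro ext)
  fix x y
  have "r x y = r ((det2 x v / det2 u v) *s u + (det2 u x / det2 u v) *s v)
     ((det2 y v / det2 u v) *s u + (det2 u y / det2 u v) *s v)"
    using frame_expand[OF assms(2)] by simp
  also have "\<dots> = frame_prod u v (k *s r u u) (k *s r u v) (k *s r v u) (k *s r v v) x y"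
    by (simp add: Bil_lin[OF assms(1)] frame_prod_def k_def vec_eq_iff power2_eq_square
        algebra_simps)
  finally show "r x y = frame_prod u v (k *s r u u) (k *s r u v) (k *s r v u) (k *s r v v) x y" .
qed

lemma Bil_eqI:
  assumes "r \<in> Bil" "s \<in> Bil" "det2 u v \<noteq> 0"
    "r u u = s u u" "r u v = s u v" "r v u = s v u" "r v v = s v v"
  shows "r = s"
  using Bil_eq_frame_prod[OF assms(1,3)] Bil_eq_frame_prod[OF assms(2,3)] assms(4-7) by metis

section \<open>Changes of frame and transport of structure\<close>

definition frame_map :: "complex^2 \<Rightarrow> complex^2 \<Rightarrow> complex^2 \<Rightarrow> complex^2" where
  "frame_map u v x = x$1 *s u + x$2 *s v"

lemma frame_map_basis [simp]: "frame_map u v e1 = u" "frame_map u v e2 = v"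
  by (simp_all add: frame_map_def basis2_def axis_def)

lemma frame_map_GL2:
  assumes "det2 u v \<noteq> 0"
  shows "frame_map u v \<in> GL2"
proof -
  have "clinear2 (frame_map u v)"
    by (simp add: clinear2_iff frame_map_def vec_eq_iff algebra_simps)
  moreover have "inj (frame_map u v)"
    unfolding inj_def frame_map_def using frame_eq_iff[OF assms]
    by (auto simp: vec_eq_iff forall_2)
  moreover have "surj (frame_map u v)"
  proof (rule surjI)
    show "frame_map u v (vector [det2 x v / det2 u v, det2 u x / det2 u v]) = x" for x
      unfolding frame_map_def using frame_expand[OF assms, of x] by simp
  qed
  ultimately show ?thesis by (simp add: GL2_def bij_def)
qed

lemma GL2_lin:
  assumes "g \<in> GL2"
  shows "g (x + y) = g x + g y" "g (c *s x) = c *s g x" "g (x - y) = g x - g y"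
    "g (inv g x) = x" "inv g (g x) = x"
    "inv g (x + y) = inv g x + inv g y" "inv g (c *s x) = c *s inv g x"
proof -
  have lin: "g (x + y) = g x + g y" "g (c *s x) = c *s g x" for x y c
    using assms by (auto simp: GL2_def clinear2_iff)
  have b: "bij g" using assms by (simp add: GL2_def)
  have gi: "g (inv g x) = x" "inv g (g x) = x" for x
    using b by (auto simp: bij_def surj_f_inv_f)
  show "g (x + y) = g x + g y" "g (c *s x) = c *s g x" "g (inv g x) = x" "inv g (g x) = x"
    by (fact lin gi)+
  show "g (x - y) = g x - g y"
    using lin(1)[of "x - y" y] by (simp add: algebra_simps)
  show "inv g (x + y) = inv g x + inv g y" "inv g (c *s x) = c *s inv g x"
    by (metis lin gi)+
qed

lemma transport_Bil:
  assumes "g \<in> GL2" "r \<in> Bil"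
  shows "transport g r \<in> Bil"
  unfolding Bil_def transport_def clinear2_iff
  by (simp add: GL2_lin[OF assms(1)] Bil_lin[OF assms(2)])

text \<open>The determinant of \<open>g x\<close> and \<open>g y\<close> is \<open>det2 x y\<close>
  times that of the image frame. If the latter were zero, surjectivity of \<open>g\<close> would
  give \<open>det2 e1 e2 = 0\<close>.\<close>

lemma GL2_det2:
  assumes "g \<in> GL2"
  shows "det2 (g e1) (g e2) \<noteq> 0"
proof
  assume 0: "det2 (g e1) (g e2) = 0"
  have g: "g x = x$1 *s g e1 + x$2 *s g e2" for x
  proof -
    have "x = x$1 *s e1 + x$2 *s e2"
      by (simp add: vec_eq_iff forall_2 basis2_def axis_def)
    then show ?thesis by (metis GL2_lin(1,2)[OF assms])
  qed
  have "det2 (g x) (g y) = 0" for x y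
  proof -
    have "det2 (g x) (g y) = det2 x y * det2 (g e1) (g e2)"
      unfolding g[of x] g[of y] det2_def by (simp add: algebra_simps)
    then show ?thesis using 0 by simp
  qed
  then have "det2 e1 e2 = 0"
    by (metis GL2_lin(4)[OF assms])
  then show False
    by (simp add: det2_def basis2_def axis_def)
qed

text \<open>By linearity and \<open>inv g (g x) = x\<close>, both sides of each transported identity
  are \<open>g\<close> applied to the sides of the original one, evaluated at preimages.\<close>

lemma transport_NP_variety:
  assumes "g \<in> GL2" "(m, n) \<in> NP_variety"
  shows "(transport g m, transport g n) \<in> NP_variety"
proof -
  have Bil: "m \<in> Bil" "n \<in> Bil"
    and mc: "\<And>x y. m x y = m y x" and ma: "\<And>x y z. m (m x y) z = m x (m y z)"
    and ls: "\<And>x y z. n (n x y) z - n x (n y z) = n (n y x) z - n y (n x z)"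
    and nr: "\<And>x y z. n (n x y) z = n (n x z) y"
    and c1: "\<And>x y z. n (m x y) z = m x (n y z)"
    and c2: "\<And>x y z. m (n x y) z - m (n y x) z = n x (m y z) - n y (m x z)"
    using assms(2)
    unfolding NP_variety_def comm_assoc_prod_def novikov_prod_def novikov_poisson_compat_def
    by blast+
  note g = GL2_lin(3,5)[OF assms(1)]
  have "comm_assoc_prod (transport g m)"
    unfolding comm_assoc_prod_def transport_def
    by (intro conjI allI; (simp only: g(2))?; rule arg_cong[where f=g]; rule mc ma)
  moreover have "novikov_prod (transport g n)"
    unfolding novikov_prod_def transport_def
    by (intro conjI allI; simp only: g(2) g(1)[symmetric]; rule arg_cong[where f=g]; rule ls nr)
  moreover have "novikov_poisson_compat (transport g m) (transport g n)"
    unfolding novikov_poisson_compat_def transport_def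
    by (intro conjI allI; simp only: g(2) g(1)[symmetric]; rule arg_cong[where f=g]; rule c1 c2)
  ultimately show ?thesis
    using transport_Bil[OF assms(1)] Bil by (simp add: NP_variety_def)
qed

lemma orbit_subset_NP_variety:
  assumes "p \<in> NP_variety"
  shows "orbit p \<subseteq> NP_variety"
  using assms transport_NP_variety[of _ "fst p" "snd p"] unfolding orbit_def by auto

lemma transport_table_frame:
  assumes "g \<in> GL2"
  shows "transport g (prod_table a b c d) (g e1) (g e1) = g a"
    "transport g (prod_table a b c d) (g e1) (g e2) = g b"
    "transport g (prod_table a b c d) (g e2) (g e1) = g c"
    "transport g (prod_table a b c d) (g e2) (g e2) = g d"
  by (simp_all add: transport_def GL2_lin[OF assms] prod_table_basis)

lemma transport_table_eqI:
  assumes "r \<in> Bil" "det2 u v \<noteq> 0"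
    "r u u = frame_map u v a" "r u v = frame_map u v b"
    "r v u = frame_map u v c" "r v v = frame_map u v d"
  shows "r = transport (frame_map u v) (prod_table a b c d)"
  using transport_table_frame[OF frame_map_GL2[OF assms(2)], of a b c d] assms
  by (intro Bil_eqI[OF assms(1) transport_Bil[OF frame_map_GL2[OF assms(2)] prod_table_Bil]
        assms(2)]) simp_all


section \<open>The two families\<close>

definition diag_pair :: "complex^2 \<Rightarrow> complex^2 \<Rightarrow> complex \<Rightarrow> complex \<Rightarrow> complex \<Rightarrow> complex \<Rightarrow>
    prod2 \<times> prod2" where
  "diag_pair u v l k a b =
     (frame_prod u v (l *s u) 0 0 (k *s v), frame_prod u v (a *s u) 0 0 (b *s v))"

definition tri_pair :: "complex^2 \<Rightarrow> complex^2 \<Rightarrow> complex \<Rightarrow> complex \<Rightarrow> complex \<Rightarrow> complex \<Rightarrow>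
    complex \<Rightarrow> prod2 \<times> prod2" where
  "tri_pair u v l k a b c =
     (frame_prod u v (l *s u + k *s v) (l *s v) (l *s v) 0,
      frame_prod u v (a *s u + c *s v) (b *s v) (a *s v) 0)"

text \<open>Entries 0 to 3 are the frame, which may be degenerate, so that the parameters fill a
  whole affine space.\<close>

definition diag_param :: "(nat \<Rightarrow> complex) \<Rightarrow> prod2 \<times> prod2" where
  "diag_param w =
     diag_pair (vector [w 0, w 1]) (vector [w 2, w 3]) (w 4) (w 5) (w 6) (w 7)"

definition tri_param :: "(nat \<Rightarrow> complex) \<Rightarrow> prod2 \<times> prod2" where
  "tri_param w =
     tri_pair (vector [w 0, w 1]) (vector [w 2, w 3]) (w 4) (w 5) (w 6) (w 7) (w 8)"

lemma vector_2_components: "vector [x$1, x$2] = (x :: complex^2)"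
  by (simp add: vec_eq_iff forall_2)

lemma diag_pair_in_range: "diag_pair u v l k a b \<in> range diag_param"
  by (rule range_eqI[of _ _ "(!) [u$1, u$2, v$1, v$2, l, k, a, b]"])
    (simp add: diag_param_def vector_2_components eval_nat_numeral)

lemma tri_pair_in_range: "tri_pair u v l k a b c \<in> range tri_param"
  by (rule range_eqI[of _ _ "(!) [u$1, u$2, v$1, v$2, l, k, a, b, c]"])
    (simp add: tri_param_def vector_2_components eval_nat_numeral)

lemma poly_param_diag: "poly_param diag_param"
  unfolding poly_param_def
proof (intro conjI ballI allI)
  show "range diag_param \<subseteq> Bil \<times> Bil"
    by (auto simp: diag_param_def diag_pair_def frame_prod_Bil)
  fix f w w' assume "f \<in> structure_consts"
  then obtain i j k where f: "f = (\<lambda>p. fst p (basis2 i) (basis2 j) $ k) \<or>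
    f = (\<lambda>p. snd p (basis2 i) (basis2 j) $ k)"
    unfolding structure_consts_def by blast
  show "is_cpoly (\<lambda>t. f (diag_param (line w w' t)))"
    using f exhaust_2[of k]
    by (elim disjE; simp add: diag_param_def diag_pair_def frame_prod_def det2_def;
        intro is_cpoly_intros is_cpoly_line)
qed

lemma poly_param_tri: "poly_param tri_param"
  unfolding poly_param_def
proof (intro conjI ballI allI)
  show "range tri_param \<subseteq> Bil \<times> Bil"
    by (auto simp: tri_param_def tri_pair_def frame_prod_Bil)
  fix f w w' assume "f \<in> structure_consts"
  then obtain i j k where f: "f = (\<lambda>p. fst p (basis2 i) (basis2 j) $ k) \<or>
    f = (\<lambda>p. snd p (basis2 i) (basis2 j) $ k)"
    unfolding structure_consts_def by blast
  show "is_cpoly (\<lambda>t. f (tri_param (line w w' t)))"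
    using f exhaust_2[of k]
    by (elim disjE; simp add: tri_param_def tri_pair_def frame_prod_def det2_def;
        intro is_cpoly_intros is_cpoly_line)
qed

text \<open>Being diagonal in a frame is a linear condition, so the normalising factor
  \<open>?d\<close> is absorbed into the four coefficients.\<close>

lemma diag_pairI:
  assumes "m \<in> Bil" "n \<in> Bil" "det2 u v \<noteq> 0"
    and "m u u = l *s u" "m u v = 0" "m v u = 0" "m v v = k *s v"
    and "n u u = a *s u" "n u v = 0" "n v u = 0" "n v v = b *s v"
  shows "(m, n) \<in> range diag_param"
proof -
  let ?d = "1 / (det2 u v)\<^sup>2"
  have "(m, n) = diag_pair u v (?d * l) (?d * k) (?d * a) (?d * b)"
    using Bil_eq_frame_prod[OF assms(1,3)] Bil_eq_frame_prod[OF assms(2,3)]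
    by (simp add: assms(4-) diag_pair_def)
  then show ?thesis using diag_pair_in_range by simp
qed

lemma tri_pairI:
  assumes "m \<in> Bil" "n \<in> Bil" "det2 u v \<noteq> 0"
    and "m u u = l *s u + k *s v" "m u v = l *s v" "m v u = l *s v" "m v v = 0"
    and "n u u = a *s u + c *s v" "n u v = b *s v" "n v u = a *s v" "n v v = 0"
  shows "(m, n) \<in> range tri_param"
proof -
  let ?d = "1 / (det2 u v)\<^sup>2"
  have "(m, n) = tri_pair u v (?d * l) (?d * k) (?d * a) (?d * b) (?d * c)"
    using Bil_eq_frame_prod[OF assms(1,3)] Bil_eq_frame_prod[OF assms(2,3)]
    by (simp add: assms(4-) tri_pair_def vector_add_ldistrib)
  then show ?thesis using tri_pair_in_range by simp
qed

section \<open>The orbit unions and the generic members of the families\<close>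

abbreviation "U07 \<equiv> \<Union>\<alpha>. \<Union>\<beta>. orbit (N07 \<alpha> \<beta>)"
abbreviation "U08 \<equiv> \<Union>\<alpha>. \<Union>\<beta>. orbit (N08 \<alpha> \<beta>)"

lemma U07_subset: "U07 \<subseteq> NP_variety"
  using orbit_subset_NP_variety N07_in_variety by blast

lemma U08_subset: "U08 \<subseteq> NP_variety"
  using orbit_subset_NP_variety N08_in_variety by blast

lemma NP_variety_Bil: "NP_variety \<subseteq> Bil \<times> Bil"
  by (auto simp: NP_variety_def)

lemma GL2_zero: "g \<in> GL2 \<Longrightarrow> g 0 = 0"
  using GL2_lin(2)[of g 0 0] by simp

lemma U07_subset_range: "U07 \<subseteq> range diag_param"
proof clarify
  fix p \<alpha> \<beta> assume "p \<in> orbit (N07 \<alpha> \<beta>)"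
  then obtain g where g: "g \<in> GL2"
    and p: "p = (transport g (fst (N07 \<alpha> \<beta>)), transport g (snd (N07 \<alpha> \<beta>)))"
    unfolding orbit_def by blast
  show "p \<in> range diag_param"
    unfolding p N07_def fst_conv snd_conv
    using GL2_lin(2)[OF g, of 1]
    by (intro diag_pairI[OF _ _ GL2_det2[OF g], where l=1 and k=1 and a=\<alpha> and b=\<beta>]
        transport_Bil g prod_table_Bil)
      (simp_all add: transport_table_frame[OF g] GL2_lin[OF g] GL2_zero[OF g])
qed

lemma U08_subset_range: "U08 \<subseteq> range tri_param"
proof clarify
  fix p \<alpha> \<beta> assume "p \<in> orbit (N08 \<alpha> \<beta>)"
  then obtain g where g: "g \<in> GL2"
    and p: "p = (transport g (fst (N08 \<alpha> \<beta>)), transport g (snd (N08 \<alpha> \<beta>)))"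
    unfolding orbit_def by blast
  show "p \<in> range tri_param"
    unfolding p N08_def fst_conv snd_conv
    by (intro tri_pairI[OF _ _ GL2_det2[OF g], where l=1 and k=0 and a=\<alpha> and b=\<beta> and c=1]
        transport_Bil g prod_table_Bil)
      (simp_all add: transport_table_frame[OF g] GL2_lin[OF g] GL2_zero[OF g])
qed

lemma in_U07:
  assumes "m \<in> Bil" "n \<in> Bil" "det2 u v \<noteq> 0"
    and "m u u = u" "m u v = 0" "m v u = 0" "m v v = v"
    and "n u u = a *s u" "n u v = 0" "n v u = 0" "n v v = b *s v"
  shows "(m, n) \<in> U07"
proof -
  have g: "frame_map u v \<in> GL2" using frame_map_GL2 assms(3) .
  have "m = transport (frame_map u v) (fst (N07 a b))"
    "n = transport (frame_map u v) (snd (N07 a b))"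
    unfolding N07_def fst_conv snd_conv using assms
    by (auto intro!: transport_table_eqI simp: GL2_lin[OF g] GL2_zero[OF g])
  then show ?thesis using g unfolding orbit_def by blast
qed

lemma in_U08:
  assumes "m \<in> Bil" "n \<in> Bil" "det2 u v \<noteq> 0"
    and "m u u = u" "m u v = v" "m v u = v" "m v v = 0"
    and "n u u = a *s u + v" "n u v = b *s v" "n v u = a *s v" "n v v = 0"
  shows "(m, n) \<in> U08"
proof -
  have g: "frame_map u v \<in> GL2" using frame_map_GL2 assms(3) .
  have "m = transport (frame_map u v) (fst (N08 a b))"
    "n = transport (frame_map u v) (snd (N08 a b))"
    unfolding N08_def fst_conv snd_conv using assms
    by (auto intro!: transport_table_eqI simp: GL2_lin[OF g] GL2_zero[OF g])
  then show ?thesis using g unfolding orbit_def by blast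
qed

text \<open>With \<open>D\<close> the squared determinant, \<open>u\<close> squares to
  \<open>l * D\<close> times itself, so dividing by \<open>l * D\<close> gives an idempotent;
  likewise for \<open>v\<close>.\<close>

lemma diag_pair_in_U07:
  assumes D: "det2 u v \<noteq> 0" and "l \<noteq> 0" "k \<noteq> 0"
  shows "diag_pair u v l k a b \<in> U07"
proof -
  define D where "D = (det2 u v)\<^sup>2"
  have D0: "D \<noteq> 0" using D by (simp add: D_def)
  note fr = frame_prod_frame[of u v, folded D_def]
  show ?thesis
    unfolding diag_pair_def
    by (rule in_U07[where u="(1 / (l * D)) *s u" and v="(1 / (k * D)) *s v"
          and a="a / l" and b="b / k"])
      (use assms D0 in \<open>simp_all add: frame_prod_Bil Bil_lin[OF frame_prod_Bil] fr\<close>,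
       use assms D0 in \<open>simp add: det2_def field_simps\<close>)
qed

lemma tri_pair_in_U08:
  assumes D: "det2 u v \<noteq> 0" and l: "l \<noteq> 0" and e: "c * l - k * b \<noteq> 0"
  shows "tri_pair u v l k a b c \<in> U08"
proof -
  define D where "D = (det2 u v)\<^sup>2"
  have D0: "D \<noteq> 0" using D by (simp add: D_def)
  note fr = frame_prod_frame[of u v, folded D_def]
  define p where "p = 1 / (l * D)"
  have pl: "p * l * D = 1" using l D0 by (simp add: p_def)
  \<comment> \<open>\<open>f1\<close> is the unit of the associative product: the \<open>v\<close>
    term corrects \<open>p *s u\<close> for the coefficient \<open>k\<close>.\<close>
  define f1 where "f1 = p *s u + (- k * p^2 * D) *s v"
  \<comment> \<open>\<open>f2\<close> is forced: it is what remains of \<open>f1 \<circ> f1\<close>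
    after removing \<open>a * p * D\<close> times \<open>f1\<close>. Hypothesis \<open>e\<close>
    makes it nonzero.\<close>
  define f2 where "f2 = (c * p^2 * D - k * b * p^3 * D^2) *s v"
  have f2: "c * p^2 * D - k * b * p^3 * D^2 = (c * l - k * b) * p^3 * D^2"
    using pl by algebra
  have "det2 f1 f2 = p * (c * p^2 * D - k * b * p^3 * D^2) * det2 u v"
    by (simp add: f1_def f2_def det2_def algebra_simps)
  then have f0: "det2 f1 f2 \<noteq> 0" using assms D0 l unfolding f2 by (simp add: p_def)
  show ?thesis
    unfolding tri_pair_def
    by (rule in_U08[OF frame_prod_Bil frame_prod_Bil f0, where a="a * p * D" and b="b * p * D"];
        simp only: f1_def f2_def Bil_lin[OF frame_prod_Bil] fr vec_eq_iff vector_add_component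
          vector_smult_component zero_index;
        intro allI;
        ((simp add: algebra_simps power2_eq_square power3_eq_cube; fail) | use pl in algebra))
qed

text \<open>\<open>h\<close> is the frame determinant times both coefficients of the associative
  product. The sample point is the standard frame with these coefficients 1, that is,
  \<open>N07 0 0\<close>.\<close>

lemma range_diag_subset: "range diag_param \<subseteq> zariski closure_of U07"
proof (rule range_poly_param_subset_closure[OF poly_param_diag,
      where h="\<lambda>w. (w 0 * w 3 - w 1 * w 2) * w 4 * w 5"
        and ?w1.0="(!) [1, 0, 0, 1, 1, 1, 0, 0]"])
  show "U07 \<subseteq> Bil \<times> Bil" using U07_subset NP_variety_Bil by blast
  show "is_cpoly (\<lambda>t. (line w w' t 0 * line w w' t 3 - line w w' t 1 * line w w' t 2) *
          line w w' t 4 * line w w' t 5)" for w w'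
    by (intro is_cpoly_intros is_cpoly_line)
  show "diag_param w \<in> U07" if "(w 0 * w 3 - w 1 * w 2) * w 4 * w 5 \<noteq> 0" for w
    unfolding diag_param_def using that by (intro diag_pair_in_U07) (auto simp: det2_def)
qed (simp add: eval_nat_numeral)

text \<open>\<open>h\<close> collects the three conditions of \<open>tri_pair_in_U08\<close>. The
  sample point is the standard frame with \<open>l = c = 1\<close> and \<open>k = a = b = 0\<close>,
  that is, \<open>N08 0 0\<close>.\<close>

lemma range_tri_subset: "range tri_param \<subseteq> zariski closure_of U08"
proof (rule range_poly_param_subset_closure[OF poly_param_tri,
      where h="\<lambda>w. (w 0 * w 3 - w 1 * w 2) * w 4 * (w 8 * w 4 - w 5 * w 7)"
        and ?w1.0="(!) [1, 0, 0, 1, 1, 0, 0, 0, 1]"])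
  show "U08 \<subseteq> Bil \<times> Bil" using U08_subset NP_variety_Bil by blast
  show "is_cpoly (\<lambda>t. (line w w' t 0 * line w w' t 3 - line w w' t 1 * line w w' t 2) *
          line w w' t 4 * (line w w' t 8 * line w w' t 4 - line w w' t 5 * line w w' t 7))" for w w'
    by (intro is_cpoly_intros is_cpoly_line)
  show "tri_param w \<in> U08"
    if "(w 0 * w 3 - w 1 * w 2) * w 4 * (w 8 * w 4 - w 5 * w 7) \<noteq> 0" for w
    unfolding tri_param_def using that by (intro tri_pair_in_U08) (auto simp: det2_def)
qed (simp add: eval_nat_numeral)

text \<open>The union of orbits lies in the polynomial image, which lies in the closure of that
  union. Irreducibility of the image thereby transfers.\<close>

lemma closure_U07_eq: "zariski closure_of U07 = zariski closure_of (range diag_param)"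
  by (intro subset_antisym closure_of_mono[OF U07_subset_range]
      closure_of_minimal[OF range_diag_subset]) simp

lemma closure_U08_eq: "zariski closure_of U08 = zariski closure_of (range tri_param)"
  by (intro subset_antisym closure_of_mono[OF U08_subset_range]
      closure_of_minimal[OF range_tri_subset]) simp


section \<open>Every structure is diagonal or triangular\<close>

lemma det2_eq_0_iff:
  assumes "v \<noteq> 0"
  shows "det2 v x = 0 \<longleftrightarrow> (\<exists>c. x = c *s v)"
proof
  assume 0: "det2 v x = 0"
  show "\<exists>c. x = c *s v"
  proof (cases "v $ 1 = 0")
    case False
    then show ?thesis using 0
      by (intro exI[of _ "x$1 / v$1"]) (auto simp: vec_eq_iff forall_2 det2_def field_simps)
  next
    case True
    then have "v $ 2 \<noteq> 0" using assms by (auto simp: vec_eq_iff forall_2)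
    then show ?thesis using 0 True
      by (intro exI[of _ "x$2 / v$2"]) (auto simp: vec_eq_iff forall_2 det2_def field_simps)
  qed
qed (auto simp: det2_def)

lemma clinear2_eigenvector:
  assumes "clinear2 A"
  obtains v c where "v \<noteq> 0" "A v = c *s v"
proof -
  define p q r s where "p = A e1 $ 1" "q = A e2 $ 1" "r = A e1 $ 2" "s = A e2 $ 2"
  have A: "A x = vector [p * x$1 + q * x$2, r * x$1 + s * x$2]" for x
  proof -
    have "x = x$1 *s e1 + x$2 *s e2"
      by (simp add: vec_eq_iff forall_2 basis2_def axis_def)
    then have "A x = x$1 *s A e1 + x$2 *s A e2"
      using assms by (metis clinear2_iff)
    then show ?thesis
      by (simp add: vec_eq_iff forall_2 p_q_r_s_def algebra_simps)
  qed
  show thesis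
  proof (cases "q = 0")
    case True
    show ?thesis
      by (rule that[of "vector [0, 1]" s])
        (auto simp: A True vec_eq_iff forall_2)
  next
    case False
    \<comment> \<open>\<open>c\<close> is a root of the characteristic polynomial of the matrix with
      rows \<open>p q\<close> and \<open>r s\<close>; the vector \<open>(q, c - p)\<close> satisfies
      the first row of the eigenvalue equation, and the second row is the characteristic
      equation.\<close>
    define c where "c = (p + s + csqrt ((p - s)\<^sup>2 + 4 * q * r)) / 2"
    have "(2 * c - (p + s))\<^sup>2 = (p - s)\<^sup>2 + 4 * q * r"
      unfolding c_def by (simp add: add_divide_distrib)
    then have "4 * (r * q + s * (c - p)) = 4 * (c * (c - p))"
      by (simp add: power2_eq_square algebra_simps)
    then have "r * q + s * (c - p) = c * (c - p)"
      by (metis mult_left_cancel zero_neq_numeral)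
    then show ?thesis using False
      by (intro that[of "vector [q, c - p]" c])
        (auto simp: A vec_eq_iff forall_2 algebra_simps)
  qed
qed

lemma exists_frame:
  assumes "v \<noteq> 0"
  obtains u where "det2 u v \<noteq> 0"
proof (cases "v $ 1 = 0")
  case True
  then show ?thesis using assms that[of e1]
    by (auto simp: det2_def basis2_def axis_def vec_eq_iff forall_2)
next
  case False
  then show ?thesis using that[of e2]
    by (auto simp: det2_def basis2_def axis_def)
qed

lemma det2_commute: "det2 u v = - det2 v u"
  by (simp add: det2_def)

lemma commuting_diag_or_tri:
  assumes lin: "\<And>A. A \<in> F \<Longrightarrow> clinear2 A"
    and comm: "\<And>A B x. A \<in> F \<Longrightarrow> B \<in> F \<Longrightarrow> A (B x) = B (A x)"
  obtains (diag) u v where "det2 u v \<noteq> 0"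
      "\<And>A. A \<in> F \<Longrightarrow> \<exists>a b. A u = a *s u \<and> A v = b *s v"
    | (tri) u v where "det2 u v \<noteq> 0"
      "\<And>A. A \<in> F \<Longrightarrow> \<exists>a b. A u = a *s u + b *s v \<and> A v = a *s v"
proof -
  have add: "A (x + y) = A x + A y" and scale: "A (c *s x) = c *s A x" if "A \<in> F" for A x y c
    using lin[OF that] by (auto simp: clinear2_iff)
  have indep: "det2 u v \<noteq> 0"
    if h: "A \<in> F" "u \<noteq> 0" "v \<noteq> 0" "A u = a *s u" "A v = b *s v" "a \<noteq> b" for A u v a b
  proof
    assume "det2 u v = 0"
    then obtain c where c: "v = c *s u" using det2_eq_0_iff h(2) by blast
    then have "(a * c) *s u = (b * c) *s u"
      using h(4,5) scale[OF h(1), of c u] by (simp add: mult.commute)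
    then show False using c h(2,3,6) by auto
  qed
  \<comment> \<open>\<open>B\<close> preserves the eigenspace of \<open>A\<close> for
    \<open>c\<close>. If \<open>B v\<close> were not a multiple of \<open>v\<close>, the two would
    span the plane and \<open>A\<close> would be scalar.\<close>
  have eigen: "\<exists>d. B v = d *s v"
    if "A \<in> F" "B \<in> F" "v \<noteq> 0" "A v = c *s v" "\<not> (\<forall>x. A x = c *s x)" for A B v c
  proof (rule ccontr)
    assume "\<nexists>d. B v = d *s v"
    then have D: "det2 v (B v) \<noteq> 0" using det2_eq_0_iff[OF that(3)] by blast
    have "A (B v) = c *s B v"
      using comm[OF that(1,2), of v] that(4) scale[OF that(2)] by simp
    have "A x = c *s x" for x
    proof -
      obtain a b where "x = a *s v + b *s B v" using frame_coeffs[OF D] by blast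
      then have "A x = a *s A v + b *s A (B v)" and x: "x = a *s v + b *s B v"
        by (simp_all add: add[OF that(1)] scale[OF that(1)])
      then show ?thesis
        unfolding \<open>A (B v) = c *s B v\<close> that(4) by (simp add: x vec_eq_iff algebra_simps)
    qed
    then show False using that(5) by blast
  qed
  show thesis
  proof (cases "\<exists>A u v a b. A \<in> F \<and> u \<noteq> 0 \<and> v \<noteq> 0 \<and> A u = a *s u \<and> A v = b *s v \<and> a \<noteq> b")
    case True
    then obtain A u v a b where A: "A \<in> F" "u \<noteq> 0" "v \<noteq> 0" "A u = a *s u" "A v = b *s v" "a \<noteq> b"
      by blast
    have "A v \<noteq> a *s v" "A u \<noteq> b *s u"
      using A by simp_all
    then have ns: "\<not> (\<forall>x. A x = a *s x)" "\<not> (\<forall>x. A x = b *s x)"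
      by blast+
    show ?thesis
      using diag[OF indep[OF A]] eigen[OF A(1) _ A(2,4) ns(1)] eigen[OF A(1) _ A(3,5) ns(2)]
      by blast
  next
    case single: False
    obtain v where v: "v \<noteq> 0" "\<And>B. B \<in> F \<Longrightarrow> \<exists>d. B v = d *s v"
    \<comment> \<open>An eigenvector of a nonscalar member is common to the whole family; if all
      members are scalar, any nonzero vector serves.\<close>
    proof (cases "\<forall>A\<in>F. \<exists>c. \<forall>x. A x = c *s x")
      case True
      have "e1 \<noteq> 0" by (simp add: basis2_def)
      then show ?thesis using that True by blast
    next
      case False
      then obtain A where A: "A \<in> F" "\<And>c. \<not> (\<forall>x. A x = c *s x)" by blast
      obtain v c where v: "v \<noteq> 0" "A v = c *s v"
        using clinear2_eigenvector[OF lin[OF A(1)]] by blast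
      show ?thesis
        by (rule that[OF v(1)]) (rule eigen[OF A(1) _ v A(2)])
    qed
    obtain u where D: "det2 u v \<noteq> 0" using exists_frame[OF v(1)] by blast
    have "\<exists>a b. B u = a *s u + b *s v \<and> B v = a *s v" if B: "B \<in> F" for B
    proof -
      obtain d where d: "B v = d *s v" using v(2)[OF B] by blast
      obtain a b where ab: "B u = a *s u + b *s v" using frame_coeffs[OF D] by blast
      have "a = d"
      proof (rule ccontr)
        assume "a \<noteq> d"
        \<comment> \<open>\<open>x\<close> would be an eigenvector of \<open>B\<close> for
          \<open>a\<close> beside \<open>v\<close> for \<open>d\<close>: two distinct eigenvalues,
          which this case excludes.\<close>
        define x where "x = u + (b / (a - d)) *s v"
        have "det2 x v = det2 u v"
          by (simp add: x_def det2_def algebra_simps)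
        then have "x \<noteq> 0" using D by (auto simp: det2_def)
        moreover have "B x = a *s x"
          using \<open>a \<noteq> d\<close> unfolding x_def add[OF B] scale[OF B] ab d
          by (simp add: vec_eq_iff field_simps)
        ultimately show False
          using single v(1) d B \<open>a \<noteq> d\<close> by blast
      qed
      then show ?thesis using ab d by blast
    qed
    then show ?thesis using tri[OF D] by blast
  qed
qed

text \<open>\<open>r u v\<close> is a multiple of \<open>v\<close> and \<open>r v u\<close> a
  multiple of \<open>u\<close>; being equal, both vanish.\<close>

lemma commutative_diag:
  assumes "r \<in> Bil" "det2 u v \<noteq> 0" "r u v = r v u"
    and "\<And>x. \<exists>a b. r x u = a *s u \<and> r x v = b *s v"
  obtains a b where "r u u = a *s u" "r u v = 0" "r v u = 0" "r v v = b *s v"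
proof -
  obtain a a' b b' where *: "r u u = a *s u" "r u v = a' *s v" "r v u = b' *s u" "r v v = b *s v"
    using assms(4) by metis
  then have "0 *s u + a' *s v = b' *s u + 0 *s v"
    using assms(3) by simp
  then have "a' = 0" "b' = 0"
    unfolding frame_eq_iff[OF assms(2)] by simp_all
  then have "r u v = 0" "r v u = 0" using * by simp_all
  then show thesis using that *(1,4) by blast
qed

text \<open>Comparing \<open>r u v\<close>, a multiple of \<open>v\<close>, with
  \<open>r v u\<close> kills the diagonal entry of multiplication by \<open>v\<close>, so
  \<open>v\<close> squares to zero.\<close>

lemma commutative_tri:
  assumes "r \<in> Bil" "det2 u v \<noteq> 0" "r u v = r v u"
    and "\<And>x. \<exists>a b. r x u = a *s u + b *s v \<and> r x v = a *s v"
  obtains a b where "r u u = a *s u + b *s v" "r u v = a *s v" "r v u = a *s v" "r v v = 0"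
proof -
  obtain a b c d where *: "r u u = a *s u + b *s v" "r u v = a *s v"
    "r v u = c *s u + d *s v" "r v v = c *s v"
    using assms(4) by metis
  then have "0 *s u + a *s v = c *s u + d *s v"
    using assms(3) by simp
  then have "c = 0" "d = a"
    unfolding frame_eq_iff[OF assms(2)] by simp_all
  then show thesis using that * by simp
qed

lemma commutative_in_range:
  assumes Z: "(m, n) \<in> NP_variety" and comm: "\<And>x y. n x y = n y x"
  shows "(m, n) \<in> range diag_param \<union> range tri_param"
proof -
  have Bil: "m \<in> Bil" "n \<in> Bil"
    and mc: "\<And>x y. m x y = m y x" and ma: "\<And>x y z. m (m x y) z = m x (m y z)"
    and nr: "\<And>x y z. n (n x y) z = n (n x z) y"
    and c: "\<And>x y z. n (m x y) z = m x (n y z)"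
    using Z unfolding NP_variety_def comm_assoc_prod_def novikov_prod_def novikov_poisson_compat_def
    by auto
  \<comment> \<open>For commutative \<open>n\<close>, associativity of \<open>m\<close>, right
    commutativity of \<open>n\<close> and the first compatibility say that all multiplication
    operators commute.\<close>
  have mm: "m x (m y z) = m y (m x z)" for x y z
    by (metis mc ma)
  have nn: "n x (n y z) = n y (n x z)" for x y z
    by (metis comm nr)
  have mn: "m x (n y z) = n y (m x z)" for x y z
    by (metis comm c)
  define F where "F = range m \<union> range n"
  have lin: "clinear2 A" if "A \<in> F" for A
    using that Bil unfolding F_def Bil_def by auto
  have cF: "A (B x) = B (A x)" if "A \<in> F" "B \<in> F" for A B x
    using that mm nn mn unfolding F_def by auto
  from lin cF show ?thesis
  proof (rule commuting_diag_or_tri)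
    fix u v assume D: "det2 u v \<noteq> 0" and E: "\<And>A. A \<in> F \<Longrightarrow> \<exists>a b. A u = a *s u \<and> A v = b *s v"
    have "\<exists>a b. m x u = a *s u \<and> m x v = b *s v" "\<exists>a b. n x u = a *s u \<and> n x v = b *s v" for x
      using E unfolding F_def by auto
    note 1 = commutative_diag[OF Bil(1) D mc this(1)] and 2 = commutative_diag[OF Bil(2) D comm this(2)]
    show ?thesis
      by (rule 1, rule 2) (use diag_pairI[OF Bil D] in blast)
  next
    fix u v assume D: "det2 u v \<noteq> 0"
      and E: "\<And>A. A \<in> F \<Longrightarrow> \<exists>a b. A u = a *s u + b *s v \<and> A v = a *s v"
    have "\<exists>a b. m x u = a *s u + b *s v \<and> m x v = a *s v"
      "\<exists>a b. n x u = a *s u + b *s v \<and> n x v = a *s v" for x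
      using E unfolding F_def by auto
    note 1 = commutative_tri[OF Bil(1) D mc this(1)] and 2 = commutative_tri[OF Bil(2) D comm this(2)]
    show ?thesis
      by (rule 1, rule 2) (use tri_pairI[OF Bil D] in blast)
  qed
qed

text \<open>The commutator of \<open>n\<close> makes the plane the non-abelian two-dimensional Lie algebra.\<close>

lemma noncommutative_frame:
  assumes n: "n \<in> Bil" and nc: "n x y \<noteq> n y x"
  obtains (goal) u v where "det2 u v \<noteq> 0" "n u v = n v u + v"
proof -
  note L = Bil_lin[OF n]
  define w where "w = n x y - n y x"
  have w0: "w \<noteq> 0" using nc by (simp add: w_def)
  have nxy: "n x y = n y x + w" by (simp add: w_def)
  have D: "det2 x y \<noteq> 0"
  proof
    assume 0: "det2 x y = 0"
    have "x \<noteq> 0" using nc L(2)[of 0 0 y] L(4)[of y 0 0] by auto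
    then obtain c where "y = c *s x" using det2_eq_0_iff 0 by blast
    then show False using nc by (simp add: L)
  qed
  obtain p q where pq: "w = p *s x + q *s y" using frame_coeffs[OF D] by blast
  \<comment> \<open>A multiple of \<open>w\<close> commutes with \<open>w\<close>, whereas
    \<open>u\<close> does not.\<close>
  have indep: "det2 u w \<noteq> 0" if "n u w = n w u + w" for u
  proof
    assume "det2 u w = 0"
    then have "det2 w u = 0" by (simp add: det2_commute[of w])
    then obtain c where "u = c *s w" using det2_eq_0_iff w0 by blast
    then show False using \<open>n u w = n w u + w\<close> w0 by (simp add: L)
  qed
  have frame: thesis if z: "n z w = n w z + c *s w" and c: "c \<noteq> 0" for z c
  proof -
    have "n ((1 / c) *s z) w = n w ((1 / c) *s z) + w"
      using c by (simp add: L z vector_add_ldistrib)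
    then show thesis using goal indep by blast
  qed
  show thesis
  \<comment> \<open>The commutator of \<open>x\<close> with \<open>w\<close> is
    \<open>q *s w\<close> and that of \<open>y\<close> with \<open>w\<close> is
    \<open>- p *s w\<close>. As \<open>w\<close> is nonzero, one of these is nonzero and can be
    rescaled to \<open>w\<close>.\<close>
  proof (cases "q = 0")
    case False
    have "n x w = n w x + q *s w"
      unfolding pq by (simp add: L nxy[unfolded pq] vec_eq_iff algebra_simps)
    then show ?thesis using False by (rule frame)
  next
    case True
    then have "- p \<noteq> 0" using pq w0 by auto
    moreover have "n y w = n w y + (- p) *s w"
      unfolding pq True by (simp add: L nxy[unfolded pq True] vec_eq_iff algebra_simps)
    ultimately show ?thesis using frame by blast
  qed
qed

text \<open>In a frame where the commutator of \<open>u\<close> and \<open>v\<close> is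
  \<open>v\<close>, the identities become equations for the structure constants. Those of
  \<open>n\<close> leave the triangular table with \<open>u \<circ> v = (a + 1) v\<close>; the
  compatibilities then make \<open>m\<close> triangular.\<close>

lemma noncommutative_in_range:
  assumes Z: "(m, n) \<in> NP_variety" and nc: "n x y \<noteq> n y x"
  shows "(m, n) \<in> range tri_param"
proof -
  have Bil: "m \<in> Bil" "n \<in> Bil"
    and mc: "\<And>x y. m x y = m y x"
    and ls: "\<And>x y z. n (n x y) z - n x (n y z) = n (n y x) z - n y (n x z)"
    and nr: "\<And>x y z. n (n x y) z = n (n x z) y"
    and c1: "\<And>x y z. n (m x y) z = m x (n y z)"
    and c2: "\<And>x y z. m (n x y) z - m (n y x) z = n x (m y z) - n y (m x z)"
    using Z unfolding NP_variety_def comm_assoc_prod_def novikov_prod_def novikov_poisson_compat_def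
    by blast+
  note Lm = Bil_lin[OF Bil(1)] and Ln = Bil_lin[OF Bil(2)]
  obtain u v where D: "det2 u v \<noteq> 0" and uv: "n u v = n v u + v"
    using noncommutative_frame[OF Bil(2) nc] by blast
  note eqI = frame_eq_iff[OF D, THEN iffD1]
  obtain p q where vu: "n v u = p *s u + q *s v" using frame_coeffs[OF D] by blast
  have uv': "n u v = p *s u + (q + 1) *s v"
    unfolding uv vu by (simp add: vec_eq_iff algebra_simps)
  obtain r s where vv: "n v v = r *s u + s *s v" using frame_coeffs[OF D] by blast
  obtain a b where uu: "n u u = a *s u + b *s v" using frame_coeffs[OF D] by blast
  have nf:
    "n (k *s u + l *s v) u = (k * a + l * p) *s u + (k * b + l * q) *s v"
    "n (k *s u + l *s v) v = (k * p + l * r) *s u + (k * (q + 1) + l * s) *s v"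
    "n u (k *s u + l *s v) = (k * a + l * p) *s u + (k * b + l * (q + 1)) *s v"
    "n v (k *s u + l *s v) = (k * p + l * r) *s u + (k * q + l * s) *s v" for k l
    by (simp_all add: Ln uu uv' vu vv vec_eq_iff algebra_simps)
  have diff: "(k *s u + l *s v) - (k' *s u + l' *s v) = (k - k') *s u + (l - l') *s v" for k l k' l'
    by (simp add: vec_eq_iff algebra_simps)
  \<comment> \<open>Left symmetry says that left multiplication by a commutator is the commutator of
    left multiplications; here the commutator of \<open>u\<close> and \<open>v\<close> is
    \<open>v\<close>.\<close>
  have ls': "n v z = n u (n v z) - n v (n u z)" for z
    using ls[of u v z] by (simp add: uv Ln algebra_simps)
  have E12: "a * p + b * r = p * a + (q + 1) * p \<and> a * (q + 1) + b * s = p * b + (q + 1) * q"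
    using nr[of u u v] by (intro eqI) (simp only: uu uv' nf)
  have E34: "p * p + q * r = r * a + s * p \<and> p * (q + 1) + q * s = r * b + s * q"
    using nr[of v u v] by (intro eqI) (simp only: vu vv nf)
  have F12: "p = (p * a + q * p) - (a * p + b * r) \<and>
      q = (p * b + q * (q + 1)) - (a * q + b * s)"
    using ls'[of u] by (intro eqI) (simp only: vu uu nf diff)
  have F34: "r = (r * a + s * p) - (p * p + (q + 1) * r) \<and>
      s = (r * b + s * (q + 1)) - (p * q + (q + 1) * s)"
    using ls'[of v] by (intro eqI) (simp only: vv uv' nf diff)
  have "2 * p = 0" using E12 F12 by algebra
  then have p: "p = 0" by simp
  have s: "s = 0" using E34 F34 p by algebra
  have "2 * r = 0" using E34 F34 p s by algebra
  then have r: "r = 0" by simp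
  have q: "q = a" using E12 F12 p s r by algebra
  note prs = p r s q
  have n': "n u u = a *s u + b *s v" "n u v = (a + 1) *s v" "n v u = a *s v" "n v v = 0"
    using uu uv' vu vv by (simp_all add: prs)
  obtain A B where muu: "m u u = A *s u + B *s v" using frame_coeffs[OF D] by blast
  obtain c d where muv: "m u v = c *s u + d *s v" using frame_coeffs[OF D] by blast
  have mvu: "m v u = c *s u + d *s v" using muv mc by simp
  obtain e f where mvv: "m v v = e *s u + f *s v" using frame_coeffs[OF D] by blast
  have nf':
    "n (k *s u + l *s v) v = 0 *s u + (k * (a + 1)) *s v"
    "n u (k *s u + l *s v) = (k * a) *s u + (k * b + l * (a + 1)) *s v"
    "n v (k *s u + l *s v) = 0 *s u + (k * a) *s v" for k l
    by (simp_all add: Ln n' vec_eq_iff algebra_simps)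
  have mf:
    "m u ((a + 1) *s v) = ((a + 1) * c) *s u + ((a + 1) * d) *s v"
    "m v ((a + 1) *s v) = ((a + 1) * e) *s u + ((a + 1) * f) *s v"
    by (simp_all add: Lm muv mvv vec_eq_iff algebra_simps)
  have c2': "m v z = n u (m v z) - n v (m u z)" for z
    using c2[of u v z] by (simp add: uv Lm)
  have G12: "0 = (a + 1) * c \<and> A * (a + 1) = (a + 1) * d"
    using c1[of u u v] by (intro eqI) (simp only: muu n'(2) nf' mf)
  have G34: "0 = (a + 1) * e \<and> c * (a + 1) = (a + 1) * f"
    using c1[of v u v] by (intro eqI) (simp only: mvu n'(2) nf' mf)
  have H12: "e = e * a - 0 \<and> f = (e * b + f * (a + 1)) - c * a"
    using c2'[of v] by (intro eqI) (simp only: mvv muv nf' diff)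
  have H34: "c = c * a - 0 \<and> d = (c * b + d * (a + 1)) - A * a"
    using c2'[of u] by (intro eqI) (simp only: mvu muu nf' diff)
  \<comment> \<open>Both \<open>c\<close> and \<open>e\<close> are annihilated by
    \<open>a + 1\<close> and by \<open>a - 1\<close>.\<close>
  have "2 * c = 0" "2 * e = 0" using G12 G34 H12 H34 by algebra+
  then have ce: "c = 0" "e = 0" by simp_all
  have f: "f = 0" using G34 H12 ce by algebra
  have d: "d = A" using G12 H34 ce by algebra
  show ?thesis
    \<comment> \<open>The coefficients \<open>c\<close> and \<open>b\<close> of
      \<open>tri_pairI\<close> are here \<open>b\<close> and \<open>a + 1\<close>.\<close>
    by (rule tri_pairI[OF Bil D, of A B a b "a + 1"])
      (simp_all add: muu muv mvu mvv n' ce f d)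
qed

lemma NP_variety_subset_ranges: "NP_variety \<subseteq> range diag_param \<union> range tri_param"
proof clarify
  fix m n assume Z: "(m, n) \<in> NP_variety" and "(m, n) \<notin> range tri_param"
  then have "n x y = n y x" for x y
    using noncommutative_in_range by blast
  then show "(m, n) \<in> range diag_param"
    using commutative_in_range[OF Z] \<open>(m, n) \<notin> range tri_param\<close> by blast
qed


section \<open>The two components\<close>

lemma self_in_orbit: "p \<in> orbit p"
proof -
  have "id \<in> GL2" by (simp add: GL2_def clinear2_iff)
  then show ?thesis
    unfolding orbit_def by (auto intro!: exI[of _ id] simp: transport_def prod_eq_iff)
qed

text \<open>Commutativity of \<open>\<circ>\<close> is a closed condition that holds on
  \<open>U07\<close> and fails for \<open>N08 0 1\<close>.\<close>

lemma closure_U08_not_subset: "\<not> zariski closure_of U08 \<subseteq> zariski closure_of U07"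
proof
  assume sub: "zariski closure_of U08 \<subseteq> zariski closure_of U07"
  \<comment> \<open>The variable \<open>z\<close> matches the three-variable form of
    \<open>closedin_identity\<close>.\<close>
  let ?C = "{p \<in> Bil \<times> Bil. \<forall>x y z::complex^2. snd p x y = snd p y x}"
  have "U07 \<subseteq> ?C"
  proof
    fix p assume p: "p \<in> U07"
    then have "p \<in> Bil \<times> Bil" using U07_subset NP_variety_Bil by blast
    moreover have "snd p x y = snd p y x" for x y
      using p by (auto simp: orbit_def N07_def transport_def prod_table_def mult.commute)
    ultimately show "p \<in> ?C" by blast
  qed
  moreover have "closedin zariski ?C"
    by (rule closedin_identity; intro regular_prod[where s=snd] regular_const disjI2 refl)
  ultimately have "zariski closure_of U07 \<subseteq> ?C"
    by (rule closure_of_minimal)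
  moreover have "U08 \<subseteq> zariski closure_of U08"
    using U08_subset NP_variety_Bil by (intro closure_of_subset) (auto simp: zariski_def)
  moreover have "N08 0 1 \<in> U08" using self_in_orbit by blast
  ultimately have "snd (N08 0 1) e1 e2 = snd (N08 0 1) e2 e1"
    using sub by blast
  then show False
    by (simp add: N08_def prod_table_basis) (simp add: basis2_def)
qed

text \<open>The separating invariant is the discriminant of the characteristic polynomial of the
  multiplication by \<^term>\<open>e1\<close>: the algebra underlying \<^const>\<open>N08\<close> is local.\<close>

lemma closure_U07_not_subset: "\<not> zariski closure_of U07 \<subseteq> zariski closure_of U08"
proof
  assume sub: "zariski closure_of U07 \<subseteq> zariski closure_of U08"
  let ?f = "\<lambda>p::prod2 \<times> prod2. (fst p e1 e1 $ 1 - fst p e1 e2 $ 2) * (fst p e1 e1 $ 1 - fst p e1 e2 $ 2) +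
    4 * (fst p e1 e2 $ 1 * fst p e1 e1 $ 2)"
  let ?C = "{p \<in> Bil \<times> Bil. ?f p = 0}"
  \<comment> \<open>Multiplications in a triangular frame have a single eigenvalue; as an identity
    in \<open>w\<close> this covers degenerate frames too.\<close>
  have "?f (tri_param w) = 0" for w
    by (simp add: tri_param_def tri_pair_def frame_prod_def det2_def basis2_def axis_def
        algebra_simps)
  then have "range tri_param \<subseteq> ?C"
    using poly_param_tri unfolding poly_param_def by blast
  then have "U08 \<subseteq> ?C"
    using U08_subset_range by blast
  moreover have "closedin zariski ?C"
    by (rule closedin_regular; intro regular_add regular_mult regular_diff
        regular_prod[where s=fst] regular_const disjI1 refl)
  ultimately have "zariski closure_of U08 \<subseteq> ?C"
    by (rule closure_of_minimal)
  moreover have "U07 \<subseteq> zariski closure_of U07"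
    using U07_subset NP_variety_Bil by (intro closure_of_subset) (auto simp: zariski_def)
  \<comment> \<open>Here multiplication by \<open>e1\<close> has eigenvalues 1 and 0, hence
    discriminant 1.\<close>
  moreover have "N07 0 0 \<in> U07" using self_in_orbit by blast
  ultimately have "?f (N07 0 0) = 0"
    using sub by blast
  then show False
    by (simp add: N07_def prod_table_basis) (simp add: basis2_def axis_def)
qed

theorem theorem43:
  shows "irreducible_components (subtopology zariski NP_variety) =
           {zariski closure_of (\<Union>\<alpha>. \<Union>\<beta>. orbit (N07 \<alpha> \<beta>)),
            zariski closure_of (\<Union>\<alpha>. \<Union>\<beta>. orbit (N08 \<alpha> \<beta>))}
       \<and> zariski closure_of (\<Union>\<alpha>. \<Union>\<beta>. orbit (N07 \<alpha> \<beta>)) \<noteq>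
         zariski closure_of (\<Union>\<alpha>. \<Union>\<beta>. orbit (N08 \<alpha> \<beta>))"
proof
  let ?C = "zariski closure_of U07" and ?D = "zariski closure_of U08"
  \<comment> \<open>The variety is closed, so closures taken in the ambient space stay inside
    it.\<close>
  have sub: "?C \<subseteq> NP_variety" "?D \<subseteq> NP_variety"
    by (intro closure_of_minimal U07_subset U08_subset closedin_NP_variety)+
  have "NP_variety \<subseteq> ?C \<union> ?D"
    using NP_variety_subset_ranges range_diag_subset range_tri_subset by blast
  then have top: "topspace (subtopology zariski NP_variety) = ?C \<union> ?D"
    using sub NP_variety_Bil by (auto simp: topspace_subtopology zariski_def)
  have irr: "irreducible_in zariski ?C" "irreducible_in zariski ?D"
    unfolding closure_U07_eq closure_U08_eq
    by (intro irreducible_in_closure_of irreducible_in_range_poly_param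
        poly_param_diag poly_param_tri)+
  have cl: "closedin (subtopology zariski NP_variety) ?C"
    "closedin (subtopology zariski NP_variety) ?D"
    using sub by (simp_all add: closedin_subset_topspace)
  show "irreducible_components (subtopology zariski NP_variety) = {?C, ?D}"
    using top cl irreducible_in_subtopology[OF irr(1) sub(1)]
      irreducible_in_subtopology[OF irr(2) sub(2)] closure_U07_not_subset closure_U08_not_subset
    by (rule irreducible_components_two)
  show "?C \<noteq> ?D"
    using closure_U07_not_subset by blast
qed

end
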